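(* Let $\alpha\in\mathbb Z\setminus\{0,1\}$, put $\gamma=\alpha^2-\alpha+1$, and let $(h_n)$ be the sequence with $h_0=0$, $h_1=1$, $h_2=-\alpha^2(\alpha-1)\gamma$, $h_3=-\alpha^6(\alpha-1)^3\gamma^3$, $h_4=\alpha^{12}(\alpha-1)^6\gamma^5$, and for $m\ge2$: $h_{2m+1}=h_{m+2}h_m^3-h_{m-1}h_{m+1}^3$, for $m\ge 3$: $h_{2m}=h_m\big(h_{m+2}h_{m-1}^2-h_{m-2}h_{m+1}^2\big)/h_2$. If $n\equiv 2,5,7,8,10,11,13,14,16,17,19,20,22,25\pmod{27}$, then $h_n$ is not a cube.
   Context: The sequence defined is the elliptic divisibility sequence attached to the point $(0,0)$ of order $9$ on the Tate normal form curve with $c=\alpha^2(\alpha-1)$, $b=c(\alpha(\alpha-1)+1)$. Convention: an integer $m$ is called a cube if $m=\beta^3$ for some nonzero integer $\beta$. *)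

theory Defs
  imports Complex_Main
begin

text \<open>
  A cube is the cube of a \<^emph>\<open>nonzero integer\<close>, so 0 is not a cube. The predicate is
  stated on the rationals because the recurrence of the sequence divides by its second
  term; \<open>\<beta>\<close> is nevertheless an integer.
\<close>

definition is_cube :: "rat \<Rightarrow> bool" where
  "is_cube x \<longleftrightarrow> (\<exists>\<beta>::int. \<beta> \<noteq> 0 \<and> x = of_int (\<beta> ^ 3))"

end

theory Submission
  imports Defs "HOL-Computational_Algebra.Nth_Powers"
begin

text \<open>
  Put \<open>a = \<alpha>\<close>, \<open>b = \<alpha> - 1\<close>, \<open>c = \<gamma>\<close> and \<open>P = a\<^sup>7 b\<^sup>4 c\<^sup>3\<close>. Since the point \<open>(0,0)\<close> has order 9,
  the sequence is quasi-periodic: \<open>h (9 q + r) = (-1)\<^sup>q P\<^bsup>9q\<^sup>2+2qr\<^esup> h r\<close>, and \<open>h r\<close> for \<open>r < 9\<close> is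
  zero or, up to sign, a monomial in \<open>a, b, c\<close>. Both recurrences are homogeneous for this scaling,
  so the closed form only has to be verified for nine residues, where it comes down to
  \<open>a = b + 1\<close>, \<open>c = a b + 1\<close> or \<open>c = a + b\<^sup>2\<close>. Modulo cubes, \<open>h n\<close> depends only on
  \<open>n mod 27\<close>. As \<open>a, b, c\<close> are pairwise coprime, each of them whose exponent is not divisible by 3
  must be a cube if \<open>h n\<close> is; for the listed residues this concerns at least two of them. But
  \<open>a\<close> and \<open>b\<close> are not both cubes, being consecutive, and if \<open>a\<close> or \<open>-b\<close> is \<open>t\<^sup>3\<close>, then
  \<open>c = t\<^sup>6 - t\<^sup>3 + 1\<close> lies strictly between consecutive cubes.
\<close>

section \<open>The closed form\<close>

text \<open>The list holds terms 0 to 8, and the factors before it carry the quasi-periodicity. With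
  \<open>a\<close>, \<open>b\<close>, \<open>c\<close> independent, every term is literally 0 or a
  signed monomial.\<close>

definition eds9 :: "int \<Rightarrow> int \<Rightarrow> int \<Rightarrow> nat \<Rightarrow> int" where
  "eds9 a b c n =
     (- 1) ^ (n div 9) * (a ^ 7 * b ^ 4 * c ^ 3) ^ (9 * (n div 9)\<^sup>2 + 2 * (n div 9) * (n mod 9)) *
     [0, 1, - (a ^ 2 * b * c), - (a ^ 6 * b ^ 3 * c ^ 3), a ^ 12 * b ^ 6 * c ^ 5,
      a ^ 19 * b ^ 10 * c ^ 8, - (a ^ 27 * b ^ 15 * c ^ 12), - (a ^ 37 * b ^ 21 * c ^ 16),
      a ^ 49 * b ^ 28 * c ^ 21] ! (n mod 9)"

text \<open>Here \<open>r\<close> may exceed 8: the quadratic exponent is compatible with composing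
  shifts, so a carry \<open>t\<close> out of \<open>r\<close> is absorbed.\<close>

lemma eds9_shift:
  "eds9 a b c (9 * q + r) =
     (- 1) ^ q * (a ^ 7 * b ^ 4 * c ^ 3) ^ (9 * q\<^sup>2 + 2 * q * r) * eds9 a b c r"
proof -
  define t where "t = r div 9"
  define s where "s = r mod 9"
  have r: "r = 9 * t + s" and s: "s < 9"
    by (simp_all add: t_def s_def)
  have "9 * (q + t)\<^sup>2 + 2 * (q + t) * s = (9 * q\<^sup>2 + 2 * q * r) + (9 * t\<^sup>2 + 2 * t * s)"
    by (simp add: r power2_eq_square algebra_simps)
  moreover have "(9 * q + r) div 9 = q + t" "(9 * q + r) mod 9 = s"
    using s by (simp_all add: r)
  ultimately show ?thesis
    by (simp add: eds9_def power_add mult_ac flip: t_def s_def)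
qed

text \<open>The factor leading from \<open>k mod 9 + j\<close> to \<open>k + j\<close> is geometric
  in \<open>j\<close>, and doubling the index turns \<open>W\<close> into \<open>W ^ 4\<close>.
  Hence both sides of the odd recurrence scale by \<open>W ^ 4 * Y ^ 10\<close>, and both sides of
  the even one by \<open>W ^ 4 * Y ^ 12\<close>.\<close>

lemma eds9_scaling:
  obtains W Y where "\<And>j. eds9 a b c (k + j) = W * Y ^ j * eds9 a b c (k mod 9 + j)"
    and "\<And>j. eds9 a b c (2 * k + j) = W ^ 4 * (Y\<^sup>2) ^ j * eds9 a b c (2 * (k mod 9) + j)"
proof -
  define q where "q = k div 9"
  define r where "r = k mod 9"
  define P where "P = a ^ 7 * b ^ 4 * c ^ 3"
  define Y where "Y = P ^ (2 * q)"
  define W where "W = (- 1) ^ q * P ^ (9 * q\<^sup>2 + 2 * q * r)"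
  have k: "k = 9 * q + r"
    by (simp add: q_def r_def)
  show thesis
  proof
    fix j
    have "eds9 a b c (k + j) = (- 1) ^ q * P ^ (9 * q\<^sup>2 + 2 * q * (r + j)) * eds9 a b c (r + j)"
      using eds9_shift[of a b c q "r + j"] by (simp add: k P_def add.assoc)
    also have "9 * q\<^sup>2 + 2 * q * (r + j) = (9 * q\<^sup>2 + 2 * q * r) + 2 * q * j"
      by (simp add: algebra_simps)
    finally show "eds9 a b c (k + j) = W * Y ^ j * eds9 a b c (k mod 9 + j)"
      by (simp add: W_def Y_def power_add power_mult flip: r_def)
  next
    fix j
    have W4: "W ^ 4 = P ^ (4 * (9 * q\<^sup>2 + 2 * q * r))"
    proof -
      have "((- 1) ^ q) ^ 4 = (1 :: int)"
        by (cases "even q") auto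
      then show ?thesis
        by (simp add: W_def power_mult_distrib mult.commute flip: power_mult)
    qed
    have "2 * k + j = 9 * (2 * q) + (2 * r + j)"
      by (simp add: k)
    then have "eds9 a b c (2 * k + j)
        = P ^ (9 * (2 * q)\<^sup>2 + 2 * (2 * q) * (2 * r + j)) * eds9 a b c (2 * r + j)"
      using eds9_shift[of a b c "2 * q" "2 * r + j"] by (simp only: P_def) simp
    also have "9 * (2 * q)\<^sup>2 + 2 * (2 * q) * (2 * r + j)
        = 4 * (9 * q\<^sup>2 + 2 * q * r) + 2 * q * (2 * j)"
      by (simp add: algebra_simps power2_eq_square)
    finally show "eds9 a b c (2 * k + j) = W ^ 4 * (Y\<^sup>2) ^ j * eds9 a b c (2 * (k mod 9) + j)"
      by (simp only: W4 Y_def power_add power_mult flip: r_def)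
  qed
qed

text \<open>This is the odd recurrence at \<open>m = k + 2\<close>, which avoids truncated
  subtraction.\<close>

lemma eds9_odd:
  assumes "a = b + 1" "c = a * b + 1"
  shows "eds9 a b c (2 * k + 5) =
    eds9 a b c (k + 4) * eds9 a b c (k + 2) ^ 3 - eds9 a b c (k + 1) * eds9 a b c (k + 3) ^ 3"
proof -
  define r where "r = k mod 9"
  have "r < 9"
    by (simp add: r_def)
  then have r: "r \<in> {0, 1, 2, 3, 4, 5, 6, 7, 8}"
    by auto
  have c': "c = a + b\<^sup>2"
    using assms by algebra
  \<comment> \<open>Multiplying the relations by the common monomial keeps the Groebner basis search short.\<close>
  have rel: "a ^ 18 * b ^ 9 * c ^ 8 * c = a ^ 18 * b ^ 9 * c ^ 8 * (a * b + 1)"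
    "a ^ 37 * b ^ 19 * c ^ 16 * c = a ^ 37 * b ^ 19 * c ^ 16 * (a + b\<^sup>2)"
    "a ^ 93 * b ^ 51 * c ^ 40 * c = a ^ 93 * b ^ 51 * c ^ 40 * (a + b\<^sup>2)"
    "a ^ 130 * b ^ 73 * c ^ 56 * c = a ^ 130 * b ^ 73 * c ^ 56 * (a * b + 1)"
    by (simp_all only: flip: assms(2) c')
  \<comment> \<open>Residues 0, 1, 3, 4 use \<open>rel\<close>. In each other residue the index 9
    occurs, where the sequence vanishes, so only monomials are compared.\<close>
  have "\<forall>r\<in>{0, 1, 2, 3, 4, 5, 6, 7, 8}. eds9 a b c (2 * r + 5) =
      eds9 a b c (r + 4) * eds9 a b c (r + 2) ^ 3 - eds9 a b c (r + 1) * eds9 a b c (r + 3) ^ 3"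
    by (simp add: eds9_def power_mult_distrib del: mult_cancel_left mult_cancel_right
        flip: power_mult)
      (intro conjI, use rel(1) in algebra, use rel(2) in algebra, algebra, use rel(3) in algebra,
        use rel(4) in algebra, algebra+)
  with r have base: "eds9 a b c (2 * r + 5) =
      eds9 a b c (r + 4) * eds9 a b c (r + 2) ^ 3 - eds9 a b c (r + 1) * eds9 a b c (r + 3) ^ 3"
    by (rule bspec[rotated])
  obtain W Y where WY: "\<And>j. eds9 a b c (k + j) = W * Y ^ j * eds9 a b c (r + j)"
    "\<And>j. eds9 a b c (2 * k + j) = W ^ 4 * (Y\<^sup>2) ^ j * eds9 a b c (2 * r + j)"
    using eds9_scaling[of a b c k] unfolding r_def by blast
  show ?thesis
    unfolding WY base power_one_right by algebra
qed

text \<open>This is the even recurrence at \<open>m = k + 3\<close>, with the division by term 2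
  cleared to stay in the integers.\<close>

lemma eds9_even:
  assumes "a = b + 1" "c = a * b + 1"
  shows "eds9 a b c 2 * eds9 a b c (2 * k + 6) = eds9 a b c (k + 3) *
    (eds9 a b c (k + 5) * eds9 a b c (k + 2) ^ 2 - eds9 a b c (k + 1) * eds9 a b c (k + 4) ^ 2)"
proof -
  define r where "r = k mod 9"
  have "r < 9"
    by (simp add: r_def)
  then have r: "r \<in> {0, 1, 2, 3, 4, 5, 6, 7, 8}"
    by auto
  have c': "c = a + b\<^sup>2"
    using assms by algebra
  have rel: "a ^ 29 * b ^ 15 * c ^ 13 * a = a ^ 29 * b ^ 15 * c ^ 13 * (b + 1)"
    "a ^ 51 * b ^ 27 * c ^ 22 * c = a ^ 51 * b ^ 27 * c ^ 22 * (a + b\<^sup>2)"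
    "a ^ 79 * b ^ 43 * c ^ 34 * c = a ^ 79 * b ^ 43 * c ^ 34 * (a + b\<^sup>2)"
    "a ^ 113 * b ^ 63 * c ^ 49 * a = a ^ 113 * b ^ 63 * c ^ 49 * (b + 1)"
    by (simp_all only: flip: assms(1) c')
  \<comment> \<open>Residues 0 to 3 use \<open>rel\<close>; for 4 to 8 the index 9 occurs on the
    right and leaves monomials.\<close>
  have "\<forall>r\<in>{0, 1, 2, 3, 4, 5, 6, 7, 8}. eds9 a b c 2 * eds9 a b c (2 * r + 6) =
      eds9 a b c (r + 3) *
      (eds9 a b c (r + 5) * eds9 a b c (r + 2) ^ 2 - eds9 a b c (r + 1) * eds9 a b c (r + 4) ^ 2)"
    by (simp add: eds9_def power_mult_distrib del: mult_cancel_left mult_cancel_right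
        flip: power_mult)
      (intro conjI, use rel(1) in algebra, use rel(2) in algebra, use rel(3) in algebra,
        use rel(4) in algebra, algebra+)
  with r have base: "eds9 a b c 2 * eds9 a b c (2 * r + 6) = eds9 a b c (r + 3) *
      (eds9 a b c (r + 5) * eds9 a b c (r + 2) ^ 2 - eds9 a b c (r + 1) * eds9 a b c (r + 4) ^ 2)"
    by (rule bspec[rotated])
  obtain W Y where WY: "\<And>j. eds9 a b c (k + j) = W * Y ^ j * eds9 a b c (r + j)"
    "\<And>j. eds9 a b c (2 * k + j) = W ^ 4 * (Y\<^sup>2) ^ j * eds9 a b c (2 * r + j)"
    using eds9_scaling[of a b c k] unfolding r_def by blast
  have "eds9 a b c 2 * eds9 a b c (2 * k + 6) =
      W ^ 4 * (Y\<^sup>2) ^ 6 * (eds9 a b c 2 * eds9 a b c (2 * r + 6))"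
    by (simp add: WY)
  then show ?thesis
    unfolding base WY power_one_right by algebra
qed

text \<open>From index 5 on, the recurrences refer only to smaller indices, and
  \<open>h 2 \<noteq> 0\<close> lets the factor in \<open>eds9_even\<close> be cancelled.\<close>

lemma eds9_unique:
  fixes h :: "nat \<Rightarrow> rat"
  assumes rel: "a = b + 1" "c = a * b + 1"
    and h2: "h 2 \<noteq> 0"
    and init: "\<And>n. n \<le> 4 \<Longrightarrow> h n = of_int (eds9 a b c n)"
    and odd: "\<And>m. m \<ge> 2 \<Longrightarrow>
           h (2 * m + 1) = h (m + 2) * h m ^ 3 - h (m - 1) * h (m + 1) ^ 3"
    and even: "\<And>m. m \<ge> 3 \<Longrightarrow>
           h (2 * m) = h m * (h (m + 2) * h (m - 1) ^ 2 - h (m - 2) * h (m + 1) ^ 2) / h 2"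
  shows "h n = of_int (eds9 a b c n)"
proof (induction n rule: less_induct)
  case (less n)
  consider "n \<le> 4" | k where "n = 2 * k + 5" | k where "n = 2 * k + 6"
  proof -
    assume *: thesis if "n \<le> 4"
    assume **: thesis if "n = 2 * k + 5" for k
    assume ***: thesis if "n = 2 * k + 6" for k
    show thesis
    proof (cases "n \<le> 4")
      case True
      then show ?thesis by (rule *)
    next
      case False
      show ?thesis
      proof (cases "even n")
        case True
        with False have "n = 2 * ((n - 6) div 2) + 6" by presburger
        then show ?thesis by (rule ***)
      next
        case odd: False
        with False have "n = 2 * ((n - 5) div 2) + 5" by presburger
        then show ?thesis by (rule **)
      qed
    qed
  qed
  then show ?case
  proof cases
    case 1
    then show ?thesis by (rule init)
  next
    case (2 k)
    have "h n = h (k + 4) * h (k + 2) ^ 3 - h (k + 1) * h (k + 3) ^ 3"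
      using odd[of "k + 2"] by (simp add: 2 algebra_simps eval_nat_numeral)
    also have "\<dots> = of_int (eds9 a b c n)"
      using 2 by (simp add: less.IH eds9_odd[OF rel])
    finally show ?thesis .
  next
    case (3 k)
    have "h n = h (k + 3) * (h (k + 5) * h (k + 2) ^ 2 - h (k + 1) * h (k + 4) ^ 2) / h 2"
      using even[of "k + 3"] by (simp add: 3 algebra_simps eval_nat_numeral)
    also have "\<dots> = of_int (eds9 a b c 2 * eds9 a b c n) / h 2"
      using 3 by (simp add: less.IH eds9_even[OF rel])
    also have "\<dots> = of_int (eds9 a b c n)"
      using h2 init[of 2] by simp
    finally show ?thesis .
  qed
qed

section \<open>Cubes of integers\<close>

lemma is_cube_iff_is_nth_power:
  "is_cube (of_int z) \<longleftrightarrow> z \<noteq> 0 \<and> is_nth_power 3 z"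
  by (auto simp: is_cube_def is_nth_power_def simp del: of_int_power)

lemma is_nth_power_uminus:
  fixes z :: int
  assumes "odd n"
  shows "is_nth_power n (- z) \<longleftrightarrow> is_nth_power n z"
  unfolding is_nth_power_def
  by (metis assms minus_minus power_minus_odd)

text \<open>Absolute values reduce this to natural numbers; as \<open>n\<close> is odd, the sign is
  itself an \<open>n\<close>-th power.\<close>

lemma is_nth_power_mult_coprimeD:
  fixes x y :: int
  assumes "is_nth_power n (x * y)" "coprime x y" "odd n"
  shows "is_nth_power n x"
proof -
  obtain z where "x * y = z ^ n"
    using assms(1) by (auto simp: is_nth_power_def)
  then have "nat \<bar>x\<bar> * nat \<bar>y\<bar> = nat \<bar>z\<bar> ^ n"
    by (metis abs_mult nat_abs_mult_distrib nat_power_eq abs_ge_zero power_abs)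
  moreover have "coprime (nat \<bar>x\<bar>) (nat \<bar>y\<bar>)"
    using assms(2) by simp
  ultimately have "is_nth_power n (nat \<bar>x\<bar>)"
    by (metis is_nth_power_mult_coprime_nat_iff is_nth_power_nth_power)
  then obtain u where "nat \<bar>x\<bar> = u ^ n"
    by (auto simp: is_nth_power_def)
  then have "\<bar>x\<bar> = int u ^ n"
    by (metis abs_ge_zero nat_0_le of_nat_power)
  then have "is_nth_power n \<bar>x\<bar>"
    by simp
  then show ?thesis
    using is_nth_power_uminus[OF assms(3), of x] by (cases "x \<ge> 0") auto
qed

lemma is_cube_powerD:
  fixes a :: int
  assumes "is_nth_power 3 (a ^ x)" "a \<noteq> 0" "\<not> 3 dvd x"
  shows "is_nth_power 3 a"
proof -
  define k where "k = x div 3"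
  have "x = 3 * k + 1 \<or> x = 3 * k + 2"
    using assms(3) unfolding k_def by presburger
  then show ?thesis
  proof
    assume "x = 3 * k + 1"
    then have "a ^ x = a * (a ^ k) ^ 3"
      by (simp add: mult.commute flip: power_mult)
    with assms show ?thesis
      by (simp add: is_nth_power_mult_cancel_right)
  next
    assume x: "x = 3 * k + 2"
    obtain u where u: "a ^ x = u ^ 3"
      using assms(1) by (auto simp: is_nth_power_def)
    \<comment> \<open>One more factor \<open>a\<close> raises the exponent to
      \<open>3 * (k + 1)\<close>, so \<open>a\<close> times a nonzero cube is a cube.\<close>
    have "a * u ^ 3 = a * a ^ x"
      by (simp add: u)
    also have "\<dots> = (a ^ (k + 1)) ^ 3"
      by (simp add: x mult.commute eval_nat_numeral flip: power_mult power_Suc)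
    finally have "is_nth_power 3 (a * u ^ 3)"
      by simp
    moreover have "u \<noteq> 0"
      using u assms(2) by (intro notI) simp
    ultimately show ?thesis
      by (simp add: is_nth_power_mult_cancel_right)
  qed
qed

lemma is_cube_monomialD:
  fixes a b c :: int
  assumes cube: "is_nth_power 3 (a ^ x * b ^ y * c ^ z)"
    and coprime: "coprime a b" "coprime a c" "coprime b c"
    and nz: "a \<noteq> 0" "b \<noteq> 0" "c \<noteq> 0"
  shows "\<not> 3 dvd x \<Longrightarrow> is_nth_power 3 a"
    and "\<not> 3 dvd y \<Longrightarrow> is_nth_power 3 b"
    and "\<not> 3 dvd z \<Longrightarrow> is_nth_power 3 c"
proof -
  have "is_nth_power 3 (a ^ x)"
    by (rule is_nth_power_mult_coprimeD[of 3 _ "b ^ y * c ^ z"])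
      (use cube coprime in \<open>auto simp: mult_ac\<close>)
  then show "\<not> 3 dvd x \<Longrightarrow> is_nth_power 3 a"
    using nz is_cube_powerD by blast
  have "is_nth_power 3 (b ^ y)"
    by (rule is_nth_power_mult_coprimeD[of 3 _ "a ^ x * c ^ z"])
      (use cube coprime in \<open>auto simp: mult_ac coprime_commute\<close>)
  then show "\<not> 3 dvd y \<Longrightarrow> is_nth_power 3 b"
    using nz is_cube_powerD by blast
  have "is_nth_power 3 (c ^ z)"
    by (rule is_nth_power_mult_coprimeD[of 3 _ "a ^ x * b ^ y"])
      (use cube coprime in \<open>auto simp: mult_ac coprime_commute\<close>)
  then show "\<not> 3 dvd z \<Longrightarrow> is_nth_power 3 c"
    using nz is_cube_powerD by blast
qed

text \<open>In the factorization of \<open>t ^ 3 - s ^ 3\<close> the quadratic factor is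
  nonnegative, so both factors are 1; then \<open>t = s + 1\<close> forces
  \<open>3 * s * (s + 1) = 0\<close>.\<close>

lemma consecutive_cubes:
  fixes s t :: int
  assumes "t ^ 3 = s ^ 3 + 1"
  shows "s = 0 \<or> t = 0"
proof -
  have eq: "(t - s) * (t\<^sup>2 + t * s + s\<^sup>2) = 1"
    using assms by algebra
  have "4 * (t\<^sup>2 + t * s + s\<^sup>2) = (2 * t + s)\<^sup>2 + 3 * s\<^sup>2"
    by algebra
  then have "t\<^sup>2 + t * s + s\<^sup>2 \<ge> 0"
    by (smt (verit) zero_le_power2)
  with eq have "t = s + 1"
    by (smt (verit) zmult_eq_1_iff)
  then have "s * (s + 1) = 0"
    using assms by algebra
  with \<open>t = s + 1\<close> show ?thesis
    by simp
qed

lemma between_consecutive_cubes: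
  fixes s w :: int
  assumes "w ^ 3 < s ^ 3" "s ^ 3 < (w + 1) ^ 3"
  shows False
proof (cases "s \<le> w")
  case True
  then have "s ^ 3 \<le> w ^ 3"
    by (intro power_mono_odd) auto
  with assms(1) show ?thesis by simp
next
  case False
  then have "(w + 1) ^ 3 \<le> s ^ 3"
    by (intro power_mono_odd) auto
  with assms(2) show ?thesis by simp
qed

text \<open>For \<open>t \<ge> 2\<close> the right side lies strictly between the cubes of
  \<open>t^2 - 1\<close> and \<open>t^2\<close>, for \<open>t \<le> -1\<close> between those of
  \<open>t^2\<close> and \<open>t^2 + 1\<close>.\<close>

lemma cube_eq_quadratic_in_cube:
  fixes s t :: int
  assumes "s ^ 3 = (t ^ 3)\<^sup>2 - t ^ 3 + 1"
  shows "t = 0 \<or> t = 1"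
proof (rule ccontr)
  assume "\<not> ?thesis"
  then consider "t \<ge> 2" | "t \<le> - 1"
    by linarith
  then show False
  proof cases
    case 1
    have "t ^ 3 > 1"
      using 1 by (intro one_less_power) auto
    then have "s ^ 3 < ((t\<^sup>2 - 1) + 1) ^ 3"
      using assms by (simp flip: power_mult)
    \<comment> \<open>The grouping makes each part visibly nonnegative for \<open>t \<ge> 2\<close>,
      since \<open>2 * t - 3 > 0\<close>.\<close>
    moreover have "s ^ 3 - (t\<^sup>2 - 1) ^ 3 = t\<^sup>2 * (3 * t * (t - 1) + 2 * t - 3) + 2"
      unfolding assms by algebra
    moreover have "t\<^sup>2 * (3 * t * (t - 1) + 2 * t - 3) \<ge> 0"
      using 1 by (intro mult_nonneg_nonneg)
        (auto intro: add_nonneg_nonneg simp: add_diff_eq[symmetric])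
    ultimately show False
      using between_consecutive_cubes[of "t\<^sup>2 - 1" s] by linarith
  next
    case 2
    have "t ^ 3 < 0"
      using 2 by simp
    then have "(t\<^sup>2) ^ 3 < s ^ 3"
      using assms by (simp flip: power_mult)
    moreover have "(t\<^sup>2 + 1) ^ 3 - s ^ 3 = t\<^sup>2 * (2 * t\<^sup>2 + t * (t + 1) + 3)"
      unfolding assms by algebra
    moreover have "t\<^sup>2 * (2 * t\<^sup>2 + t * (t + 1) + 3) > 0"
      using 2 by (intro mult_pos_pos add_nonneg_pos add_nonneg_nonneg)
        (auto simp: mult_nonpos_nonpos)
    ultimately show False
      using between_consecutive_cubes[of "t\<^sup>2" s] by linarith
  qed
qed

section \<open>Non-cube terms\<close>

text \<open>In each of these terms at least two of the three exponents are not divisible by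
  3.\<close>

lemma eds9_eq_monomial:
  "eds9 a b c 2 = - (a ^ 2 * b ^ 1 * c ^ 1)"
    "eds9 a b c 5 = a ^ 19 * b ^ 10 * c ^ 8"
    "eds9 a b c 7 = - (a ^ 37 * b ^ 21 * c ^ 16)"
    "eds9 a b c 8 = a ^ 49 * b ^ 28 * c ^ 21"
    "eds9 a b c 10 = - (a ^ 77 * b ^ 44 * c ^ 33)"
    "eds9 a b c 11 = a ^ 93 * b ^ 53 * c ^ 40"
    "eds9 a b c 13 = - (a ^ 131 * b ^ 74 * c ^ 56)"
    "eds9 a b c 14 = - (a ^ 152 * b ^ 86 * c ^ 65)"
    "eds9 a b c 16 = a ^ 198 * b ^ 113 * c ^ 85"
    "eds9 a b c 17 = - (a ^ 224 * b ^ 128 * c ^ 96)"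
    "eds9 a b c 19 = a ^ 280 * b ^ 160 * c ^ 120"
    "eds9 a b c 20 = - (a ^ 310 * b ^ 177 * c ^ 133)"
    "eds9 a b c 22 = a ^ 376 * b ^ 214 * c ^ 161"
    "eds9 a b c 25 = - (a ^ 485 * b ^ 277 * c ^ 208)"
  by (simp_all add: eds9_def power_mult_distrib del: mult_cancel_left mult_cancel_right
      flip: power_mult)
    algebra+

lemma eds9_not_cube:
  assumes a: "a = b + 1" and c: "c = a * b + 1" and nz: "a \<noteq> 0" "b \<noteq> 0"
    and n: "n mod 27 \<in> {2, 5, 7, 8, 10, 11, 13, 14, 16, 17, 19, 20, 22, 25}"
  shows "\<not> is_nth_power 3 (eds9 a b c n)"
proof
  assume cube: "is_nth_power 3 (eds9 a b c n)"
  define p where "p = n div 27"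
  define s where "s = n mod 27"
  have "c = b\<^sup>2 + b + 1"
    by (simp add: a c power2_eq_square algebra_simps)
  moreover have "4 * (b\<^sup>2 + b + 1) = (2 * b + 1)\<^sup>2 + 3"
    by algebra
  ultimately have "c \<noteq> 0"
    by (smt (verit) zero_le_power2)
  have "n = 9 * (3 * p) + s"
    by (simp add: p_def s_def)
  then have "eds9 a b c n
      = (- 1) ^ (3 * p) * (a ^ 7 * b ^ 4 * c ^ 3) ^ (9 * (3 * p)\<^sup>2 + 2 * (3 * p) * s) * eds9 a b c s"
    by (simp only: eds9_shift)
  \<comment> \<open>Shifting by a multiple of 27 multiplies by a cube: sign and monomial both have
    exponents divisible by 3.\<close>
  also have "\<dots> = eds9 a b c s * ((- 1) ^ p * (a ^ 7 * b ^ 4 * c ^ 3) ^ (27 * p\<^sup>2 + 2 * p * s)) ^ 3"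
    by (simp add: power_mult_distrib algebra_simps flip: power_mult)
  finally have "is_nth_power 3 (eds9 a b c s)"
    using cube nz \<open>c \<noteq> 0\<close> by (simp add: is_nth_power_mult_cancel_right)
  have "c - a * b = 1" "c - b * a = 1"
    by (simp_all add: c)
  then have "coprime a c" "coprime b c"
    by (metis coprimeI dvd_diff dvd_mult2)+
  moreover have "coprime a b"
    by (simp add: a)
  ultimately have coprime: "coprime a b" "coprime a c" "coprime b c"
    by simp_all
  have ab: "\<not> (is_nth_power 3 a \<and> is_nth_power 3 b)"
    using consecutive_cubes a nz by (metis is_nth_power_def power_0_left zero_neq_numeral)
  have ac: "\<not> (is_nth_power 3 a \<and> is_nth_power 3 c)"
  proof
    assume "is_nth_power 3 a \<and> is_nth_power 3 c"
    then obtain t u where "a = t ^ 3" "c = u ^ 3"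
      by (auto simp: is_nth_power_def)
    moreover have "c = a\<^sup>2 - a + 1"
      using a c by algebra
    ultimately show False
      using cube_eq_quadratic_in_cube[of u t] a nz by auto
  qed
  have bc: "\<not> (is_nth_power 3 b \<and> is_nth_power 3 c)"
  proof
    assume "is_nth_power 3 b \<and> is_nth_power 3 c"
    then obtain t u where "- b = t ^ 3" "c = u ^ 3"
      using is_nth_power_uminus[of 3 b] by (auto simp: is_nth_power_def)
    \<comment> \<open>The quadratic is symmetric under replacing \<open>a\<close> by
      \<open>1 - a = - b\<close>.\<close>
    moreover have "c = (- b)\<^sup>2 - (- b) + 1"
      using a c by algebra
    ultimately show False
      using cube_eq_quadratic_in_cube[of u t] a nz by auto
  qed
  have no_monomial: "\<not> is_nth_power 3 (a ^ x * b ^ y * c ^ z)"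
    if "\<not> 3 dvd x \<and> \<not> 3 dvd y \<or> \<not> 3 dvd x \<and> \<not> 3 dvd z \<or> \<not> 3 dvd y \<and> \<not> 3 dvd z" for x y z
    using that is_cube_monomialD[OF _ coprime nz \<open>c \<noteq> 0\<close>] ab ac bc by blast
  have "s \<in> {2, 5, 7, 8, 10, 11, 13, 14, 16, 17, 19, 20, 22, 25}"
    using n by (simp add: s_def)
  then have "\<not> is_nth_power 3 (eds9 a b c s)"
    \<comment> \<open>The simplifier rewrites \<open>b ^ 1\<close> to \<open>b\<close>, so term 2
      needs its own instance of \<open>no_monomial\<close>.\<close>
    by (elim insertE emptyE)
      (simp_all only: eds9_eq_monomial, simp_all add: is_nth_power_uminus no_monomial
        no_monomial[of 2 1 1, unfolded power_one_right])
  with \<open>is_nth_power 3 (eds9 a b c s)\<close> show False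
    by simp
qed

theorem theorem5p18:
  fixes \<alpha> \<gamma> :: int and h :: "nat \<Rightarrow> rat" and n :: nat
  assumes "\<alpha> \<noteq> 0" and "\<alpha> \<noteq> 1"
    and "\<gamma> = \<alpha> ^ 2 - \<alpha> + 1"
    and "h 0 = 0"
    and "h 1 = 1"
    and "h 2 = of_int (- (\<alpha> ^ 2 * (\<alpha> - 1) * \<gamma>))"
    and "h 3 = of_int (- (\<alpha> ^ 6 * (\<alpha> - 1) ^ 3 * \<gamma> ^ 3))"
    and "h 4 = of_int (\<alpha> ^ 12 * (\<alpha> - 1) ^ 6 * \<gamma> ^ 5)"
    and "\<And>m. m \<ge> 2 \<Longrightarrow>
           h (2 * m + 1) = h (m + 2) * h m ^ 3 - h (m - 1) * h (m + 1) ^ 3"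
    and "\<And>m. m \<ge> 3 \<Longrightarrow>
           h (2 * m) = h m * (h (m + 2) * h (m - 1) ^ 2 - h (m - 2) * h (m + 1) ^ 2) / h 2"
    and "n mod 27 \<in> {2, 5, 7, 8, 10, 11, 13, 14, 16, 17, 19, 20, 22, 25}"
  shows "\<not> is_cube (h n)"
proof -
  have rel: "\<alpha> = (\<alpha> - 1) + 1" "\<gamma> = \<alpha> * (\<alpha> - 1) + 1"
    by (simp_all add: assms(3) power2_eq_square algebra_simps)
  have "4 * \<gamma> = (2 * \<alpha> - 1)\<^sup>2 + 3"
    unfolding assms(3) by algebra
  then have "\<gamma> \<noteq> 0"
    by (smt (verit) zero_le_power2)
  then have "h 2 \<noteq> 0"
    using assms(1,2) by (simp add: assms(6))
  moreover have "h m = of_int (eds9 \<alpha> (\<alpha> - 1) \<gamma> m)" if "m \<le> 4" for m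
  proof -
    have "m \<in> {0, 1, 2, 3, 4}"
      using that by auto
    then show ?thesis
      by (elim insertE emptyE) (simp_all only: assms(4-8), simp_all add: eds9_def)
  qed
  ultimately have "h n = of_int (eds9 \<alpha> (\<alpha> - 1) \<gamma> n)"
    by (rule eds9_unique[OF rel _ _ assms(9,10)])
  then show ?thesis
    using eds9_not_cube[OF rel _ _ assms(11)] assms(1,2) is_cube_iff_is_nth_power by simp
qed

end
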